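(* Let $A=(a_{ij})\in\hat{\mathbb H}^{n\times n}$ be a dual quaternion Hermitian matrix, let $i,j\in\{1,\dots,n\}$, and let $P_{ij}$ be the switching matrix. Then $$\mathrm{Cdet}(P_{ij}^*AP_{ij})=\mathrm{Cdet}(A),$$ where $\mathrm{Cdet}$ is the Chen determinant.
   Context: $\mathbb H$ denotes the real quaternions with conjugation $q\mapsto q^*$. A dual quaternion is $q=q_s+q_d\epsilon$ with $q_s,q_d\in\mathbb H$, where $\epsilon\neq 0$, $\epsilon^2=0$, and $\epsilon$ commutes with all quaternions; the set of dual quaternions is $\hat{\mathbb H}$, and $q^*=q_s^*+q_d^*\epsilon$. For $A=(a_{ij})\in\hat{\mathbb H}^{n\times n}$, $A^*=(a_{ji}^* )$; $A$ is Hermitian if $A^*=A$. Switching matrix: $P_{ij}\in\mathbb R^{n\times n}$ is the permutation matrix whose $(k,l)$ entry is $1$ if $k=l\notin\{i,j\}$, or $(k,l)=(i,j)$, or $(k,l)=(j,i)$, and $0$ otherwise. Chen determinant: write a permutation $\sigma$ of $\{1,\dots,n\}$ as an ordered product of disjoint cycles (fixed points included) $$\sigma=(n_{11}\cdots n_{1l_1})(n_{21}\cdots n_{2l_2})\cdots(n_{r1}\cdots n_{rl_r}),$$ where $(i_1\cdots i_k)$ means $i_1\mapsto i_2\mapsto\cdots\mapsto i_k\mapsto i_1$, arranged (uniquely) so that $n_{i1}>n_{ij}$ for all $j>1$ and $i=1,\dots,r$, and $n=n_{11}>n_{21}>\cdots>n_{r1}$. Set $$a_\sigma=(a_{n_{11}n_{12}}a_{n_{12}n_{13}}\cdots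 a_{n_{1l_1}n_{11}})(a_{n_{21}n_{22}}\cdots a_{n_{2l_2}n_{21}})\cdots(a_{n_{r1}n_{r2}}\cdots a_{n_{rl_r}n_{r1}})$$ (product in the indicated order). For an arbitrary $A=(a_{ij})\in\hat{\mathbb H}^{n\times n}$, $\mathrm{Cdet}(A)=\sum_\sigma(-1)^{n-r}a_\sigma$, summed over all permutations $\sigma$ of $\{1,\dots,n\}$, where $r$ is the number of cycles of $\sigma$. *)

theory Defs
  imports
    Complex_Main
    "HOL-Combinatorics.Cycles"
    "Jordan_Normal_Form.Gauss_Jordan_Elimination"
begin

codatatype quat = Quat (qRe: real) (qIm1: real) (qIm2: real) (qIm3: real)

lemma quat_eqI:
  "qRe x = qRe y \<Longrightarrow> qIm1 x = qIm1 y \<Longrightarrow> qIm2 x = qIm2 y \<Longrightarrow> qIm3 x = qIm3 y \<Longrightarrow> x = y"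
  by (rule quat.expand) simp

instantiation quat :: real_algebra_1
begin

primcorec zero_quat where
  "qRe 0 = 0" | "qIm1 0 = 0" | "qIm2 0 = 0" | "qIm3 0 = 0"

primcorec one_quat where
  "qRe 1 = 1" | "qIm1 1 = 0" | "qIm2 1 = 0" | "qIm3 1 = 0"

primcorec plus_quat where
  "qRe (x + y) = qRe x + qRe y"
| "qIm1 (x + y) = qIm1 x + qIm1 y"
| "qIm2 (x + y) = qIm2 x + qIm2 y"
| "qIm3 (x + y) = qIm3 x + qIm3 y"

primcorec uminus_quat where
  "qRe (- x) = - qRe x"
| "qIm1 (- x) = - qIm1 x"
| "qIm2 (- x) = - qIm2 x"
| "qIm3 (- x) = - qIm3 x"

primcorec minus_quat where
  "qRe (x - y) = qRe x - qRe y"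
| "qIm1 (x - y) = qIm1 x - qIm1 y"
| "qIm2 (x - y) = qIm2 x - qIm2 y"
| "qIm3 (x - y) = qIm3 x - qIm3 y"

primcorec scaleR_quat where
  "qRe (r *\<^sub>R x) = r * qRe x"
| "qIm1 (r *\<^sub>R x) = r * qIm1 x"
| "qIm2 (r *\<^sub>R x) = r * qIm2 x"
| "qIm3 (r *\<^sub>R x) = r * qIm3 x"

primcorec times_quat where
  "qRe (x * y) = qRe x * qRe y - qIm1 x * qIm1 y - qIm2 x * qIm2 y - qIm3 x * qIm3 y"
| "qIm1 (x * y) = qRe x * qIm1 y + qIm1 x * qRe y + qIm2 x * qIm3 y - qIm3 x * qIm2 y"
| "qIm2 (x * y) = qRe x * qIm2 y - qIm1 x * qIm3 y + qIm2 x * qRe y + qIm3 x * qIm1 y"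
| "qIm3 (x * y) = qRe x * qIm3 y + qIm1 x * qIm2 y - qIm2 x * qIm1 y + qIm3 x * qRe y"

instance
  by standard
    (auto intro!: quat_eqI simp: algebra_simps dest: arg_cong[of "0::quat" "1::quat" qRe])

end

primcorec qconj :: "quat \<Rightarrow> quat" where
  "qRe (qconj x) = qRe x"
| "qIm1 (qconj x) = - qIm1 x"
| "qIm2 (qconj x) = - qIm2 x"
| "qIm3 (qconj x) = - qIm3 x"

lemma qconj_mult: "qconj (x * y) = qconj y * qconj x"
  by (rule quat_eqI) (simp_all add: algebra_simps)

text \<open>\<open>DQuat a b\<close> is the dual quaternion $a + b\epsilon$; see \<open>DQuat_eq\<close> below.\<close>

codatatype dquat = DQuat (dq_std: quat) (dq_dual: quat)

lemma dquat_eqI: "dq_std x = dq_std y \<Longrightarrow> dq_dual x = dq_dual y \<Longrightarrow> x = y"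
  by (rule dquat.expand) simp

instantiation dquat :: real_algebra_1
begin

primcorec zero_dquat where "dq_std 0 = 0" | "dq_dual 0 = 0"

primcorec one_dquat where "dq_std 1 = 1" | "dq_dual 1 = 0"

primcorec plus_dquat where
  "dq_std (x + y) = dq_std x + dq_std y"
| "dq_dual (x + y) = dq_dual x + dq_dual y"

primcorec uminus_dquat where
  "dq_std (- x) = - dq_std x"
| "dq_dual (- x) = - dq_dual x"

primcorec minus_dquat where
  "dq_std (x - y) = dq_std x - dq_std y"
| "dq_dual (x - y) = dq_dual x - dq_dual y"

primcorec scaleR_dquat where
  "dq_std (r *\<^sub>R x) = r *\<^sub>R dq_std x"
| "dq_dual (r *\<^sub>R x) = r *\<^sub>R dq_dual x"

primcorec times_dquat where
  "dq_std (x * y) = dq_std x * dq_std y"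
| "dq_dual (x * y) = dq_std x * dq_dual y + dq_dual x * dq_std y"

instance
  by standard
    (auto intro!: dquat_eqI simp: algebra_simps dest: arg_cong[of "0::dquat" "1::dquat" dq_std])

end

lemma DQuat_eq:
  defines "\<iota> \<equiv> \<lambda>q. DQuat q 0" and "\<epsilon> \<equiv> DQuat 0 1"
  shows "DQuat a b = \<iota> a + \<iota> b * \<epsilon>" "\<epsilon> \<noteq> 0" "\<epsilon> * \<epsilon> = 0" "\<epsilon> * \<iota> a = \<iota> a * \<epsilon>"
    "\<iota> (a + b) = \<iota> a + \<iota> b" "\<iota> (a * b) = \<iota> a * \<iota> b" "\<iota> 1 = 1"
  by (auto simp: \<iota>_def \<epsilon>_def intro!: dquat_eqI dest: arg_cong[of _ _ dq_dual])

primcorec dqconj :: "dquat \<Rightarrow> dquat" where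
  "dq_std (dqconj x) = qconj (dq_std x)"
| "dq_dual (dqconj x) = qconj (dq_dual x)"

text \<open>Matrices are indexed by $0, \dots, n-1$ instead of $1, \dots, n$; this shift
  preserves the order on indices, on which the Chen determinant depends.\<close>

definition conj_transpose :: "dquat mat \<Rightarrow> dquat mat" where
  "conj_transpose A = transpose_mat (map_mat dqconj A)"

definition dq_hermitian :: "dquat mat \<Rightarrow> bool" where
  "dq_hermitian A \<longleftrightarrow> conj_transpose A = A"

text \<open>The library's \<open>swaprows_mat n i j\<close> has exactly the entries of the switching matrix
  $P_{ij}$ (the identity if $i = j$). It is taken over the reals and then embedded.\<close>

definition switching_mat :: "nat \<Rightarrow> nat \<Rightarrow> nat \<Rightarrow> dquat mat" where
  "switching_mat n i j = map_mat of_real (swaprows_mat n i j :: real mat)"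

lemma switching_mat_index:
  assumes "k < n" "l < n"
  shows "switching_mat n i j $$ (k, l) =
    (if k = l \<and> l \<notin> {i, j} \<or> (k, l) = (i, j) \<or> (k, l) = (j, i) then 1 else 0)"
  using assms by (auto simp: switching_mat_def swaprows_mat_def)

text \<open>\<open>chen_form n \<sigma> css\<close>: the list of lists \<open>css\<close> is the normalized expression of \<open>\<sigma>\<close> as an
  ordered product of disjoint cycles, fixed points included. The library function
  \<open>cycle_of_list\<close> sends $[i_1, \dots, i_k]$ to the cycle
  $i_1 \mapsto i_2 \mapsto \dots \mapsto i_k \mapsto i_1$. That the first list starts with the
  largest index follows from the stated conditions. For every permutation there is exactly
  one such list of lists; see \<open>chen_form_ex1\<close> below.\<close>

definition chen_form :: "nat \<Rightarrow> (nat \<Rightarrow> nat) \<Rightarrow> nat list list \<Rightarrow> bool" where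
  "chen_form n \<sigma> css \<longleftrightarrow>
     \<sigma> = foldr (\<circ>) (map cycle_of_list css) id \<and>
     distinct (concat css) \<and> set (concat css) = {0..<n} \<and>
     (\<forall>c\<in>set css. c \<noteq> [] \<and> (\<forall>x\<in>set (tl c). x < hd c)) \<and>
     sorted_wrt (>) (map hd css)"

definition chen_cycles :: "nat \<Rightarrow> (nat \<Rightarrow> nat) \<Rightarrow> nat list list" where
  "chen_cycles n \<sigma> = (THE css. chen_form n \<sigma> css)"

text \<open>For a cycle $[n_1, \dots, n_l]$ the product
  $a_{n_1 n_2} a_{n_2 n_3} \cdots a_{n_l n_1}$, in this order.\<close>

definition cycle_prod :: "dquat mat \<Rightarrow> nat list \<Rightarrow> dquat" where
  "cycle_prod A c = prod_list (map (\<lambda>kl. A $$ kl) (zip c (rotate1 c)))"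

definition chen_term :: "dquat mat \<Rightarrow> (nat \<Rightarrow> nat) \<Rightarrow> dquat" where
  "chen_term A \<sigma> = prod_list (map (cycle_prod A) (chen_cycles (dim_row A) \<sigma>))"

definition Cdet :: "dquat mat \<Rightarrow> dquat" where
  "Cdet A = (\<Sum>\<sigma> | \<sigma> permutes {0..<dim_row A}.
     (- 1) ^ (dim_row A - length (chen_cycles (dim_row A) \<sigma>)) * chen_term A \<sigma>)"

lemma foldr_cycles_outside:
  assumes "x \<notin> set (concat css)"
  shows "foldr (\<circ>) (map cycle_of_list css) id x = x"
  using assms by (induction css) (auto simp: id_outside_supp)

lemma foldr_cycles_inside:
  assumes "distinct (concat css)" "c \<in> set css" "x \<in> set c"
  shows "foldr (\<circ>) (map cycle_of_list css) id x = cycle_of_list c x"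
  using assms
proof (induction css)
  case (Cons d css)
  have unfold_d: "foldr (\<circ>) (map cycle_of_list (d # css)) id x =
    cycle_of_list d (foldr (\<circ>) (map cycle_of_list css) id x)"
    by simp
  show ?case
  proof (cases "x \<in> set d")
    case True
    then have "x \<notin> set (concat css)" using Cons.prems(1) by auto
    moreover have "c = d" using True Cons.prems by auto
    ultimately show ?thesis unfolding unfold_d using foldr_cycles_outside[of x css] by argo
  next
    case False
    then have c: "c \<in> set css" using Cons.prems by auto
    have "cycle_of_list c x \<in> set c"
      using cycle_is_surj[of c] c Cons.prems by (auto simp: distinct_concat_iff)
    then have "cycle_of_list c x \<notin> set d" using c Cons.prems(1) by auto
    then have "cycle_of_list d (cycle_of_list c x) = cycle_of_list c x"
      by (rule id_outside_supp)
    moreover have "distinct (concat css)" using Cons.prems(1) by simp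
    ultimately show ?thesis
      unfolding unfold_d using Cons.IH[OF _ c Cons.prems(3)] by argo
  qed
qed simp

lemma cycle_eq_support:
  assumes d: "distinct c" and ne: "c \<noteq> []" and p: "map p c = rotate1 c"
  shows "c = support p (hd c)"
proof -
  let ?l = "length c"
  have step: "p (c ! k) = c ! (Suc k mod ?l)" if "k < ?l" for k
    using arg_cong[OF p, of "\<lambda>xs. xs ! k"] that by (simp add: nth_rotate1)
  have pow: "(p ^^ k) (hd c) = c ! k" if "k < ?l" for k
    using that
  proof (induction k)
    case 0 then show ?case using ne by (simp add: hd_conv_nth)
  next
    case (Suc k) then show ?case using step[of k] by simp
  qed
  obtain m where m: "?l = Suc m" using ne by (cases c) auto
  have cyc: "(p ^^ ?l) (hd c) = hd c"
    using step[of m] pow[of m] ne by (simp add: m hd_conv_nth)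
  have "least_power p (hd c) = ?l"
    unfolding least_power_def
  proof (rule Least_equality)
    fix k assume k: "(p ^^ k) (hd c) = hd c \<and> 0 < k"
    show "?l \<le> k"
    proof (rule ccontr)
      assume "\<not> ?l \<le> k"
      then have "c ! k = c ! 0" using pow[of k] k ne by (simp add: hd_conv_nth)
      then show False using nth_eq_iff_index_eq[OF d, of k 0] k m \<open>\<not> ?l \<le> k\<close> by simp
    qed
  qed (use cyc m in auto)
  then show ?thesis by (intro nth_equalityI) (auto simp: pow)
qed

definition cycle_leaders :: "nat \<Rightarrow> (nat \<Rightarrow> nat) \<Rightarrow> nat set" where
  "cycle_leaders n \<sigma> = {m. m < n \<and> (\<forall>k. (\<sigma> ^^ k) m \<le> m)}"

lemma finite_cycle_leaders [simp]: "finite (cycle_leaders n \<sigma>)"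
  by (simp add: cycle_leaders_def)

lemma chen_form_unique:
  assumes \<sigma>: "\<sigma> permutes {0..<n}" and cf: "chen_form n \<sigma> css"
  shows "css = map (support \<sigma>) (rev (sorted_list_of_set (cycle_leaders n \<sigma>)))"
proof -
  have perm: "permutation \<sigma>" using \<sigma> permutation_permutes by blast
  have dist: "distinct (concat css)" and set: "set (concat css) = {0..<n}"
    and sort: "sorted_wrt (>) (map hd css)"
    and \<sigma>_eq: "\<sigma> = foldr (\<circ>) (map cycle_of_list css) id"
    using cf by (auto simp: chen_form_def)
  have ne: "c \<noteq> []" and mx: "\<And>x. x \<in> set c \<Longrightarrow> x \<le> hd c" if "c \<in> set css" for c
  proof -
    show "c \<noteq> []" using cf that by (auto simp: chen_form_def)
    fix x assume "x \<in> set c"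
    moreover have "\<forall>x\<in>set (tl c). x < hd c" using cf that by (auto simp: chen_form_def)
    ultimately show "x \<le> hd c" by (cases c) (auto intro: less_imp_le)
  qed
  have supp: "c = support \<sigma> (hd c)" if c: "c \<in> set css" for c
  proof (rule cycle_eq_support)
    show dc: "distinct c" using dist c by (simp add: distinct_concat_iff)
    show "c \<noteq> []" using ne c by simp
    have "map \<sigma> c = map (cycle_of_list c) c"
      unfolding \<sigma>_eq using foldr_cycles_inside[OF dist c] by (intro map_cong refl)
    also have "\<dots> = rotate1 c" using cyclic_rotation[OF dc, of 1] by simp
    finally show "map \<sigma> c = rotate1 c" .
  qed
  have "set (map hd css) = cycle_leaders n \<sigma>"
  proof (intro equalityI subsetI)
    fix m assume "m \<in> set (map hd css)"
    then obtain c where c: "c \<in> set css" "m = hd c" by auto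
    have "m \<in> set c" using c ne by auto
    then have "m < n" using set c by auto
    moreover have "(\<sigma> ^^ k) m \<le> m" for k
      using mx[OF c(1)] supp[OF c(1)] support_set[OF perm, of m] c(2) by auto
    ultimately show "m \<in> cycle_leaders n \<sigma>" by (simp add: cycle_leaders_def)
  next
    fix m assume m: "m \<in> cycle_leaders n \<sigma>"
    then have "m \<in> set (concat css)" using set by (simp add: cycle_leaders_def)
    then obtain c where c: "c \<in> set css" "m \<in> set c" by auto
    have "hd c \<in> set c" using c ne by auto
    have "m \<in> set (support \<sigma> (hd c))" using c supp by metis
    then have "set (support \<sigma> m) \<inter> set (support \<sigma> (hd c)) \<noteq> {}"
      using disjoint_support'[OF perm] by blast
    then have "hd c \<in> set (support \<sigma> m)"
      using disjoint_support'[OF perm] by blast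
    then have "hd c \<le> m"
      using m unfolding support_set[OF perm] by (auto simp: cycle_leaders_def)
    then have "m = hd c" using mx[OF c] by simp
    then show "m \<in> set (map hd css)" using c by auto
  qed
  moreover have "sorted_wrt (<) (rev (map hd css))"
    using sort by (simp add: sorted_wrt_rev)
  ultimately have "rev (map hd css) = sorted_list_of_set (cycle_leaders n \<sigma>)"
    by (metis finite_cycle_leaders set_rev sorted_list_of_set_unique
        strict_sorted_iff length_rev sorted_list_of_set.idem_if_sorted_distinct)
  then have "map hd css = rev (sorted_list_of_set (cycle_leaders n \<sigma>))"
    by (metis rev_rev_ident)
  moreover have "css = map (support \<sigma>) (map hd css)"
    using supp by (simp add: map_idI)
  ultimately show ?thesis by simp
qed

lemma chen_form_exists:
  assumes \<sigma>: "\<sigma> permutes {0..<n}"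
  shows "chen_form n \<sigma> (map (support \<sigma>) (rev (sorted_list_of_set (cycle_leaders n \<sigma>))))"
    (is "chen_form n \<sigma> ?css")
proof -
  have perm: "permutation \<sigma>" using \<sigma> permutation_permutes by blast
  note lp = least_power_of_permutation[OF perm]
  have hd_supp: "hd (support \<sigma> m) = m" for m
    using lp(2)[of m] by (simp add: hd_map)
  have ne: "support \<sigma> m \<noteq> []" for m using lp(2)[of m] by simp
  have self: "m \<in> set (support \<sigma> m)" for m using ne[of m] hd_supp[of m] by (metis hd_in_set)
  have sym: "x \<in> set (support \<sigma> y) \<Longrightarrow> y \<in> set (support \<sigma> x)" for x y
    using disjoint_support'[OF perm] by blast
  have eq: "set (support \<sigma> x) = set (support \<sigma> y)" if "x \<in> set (support \<sigma> y)" for x y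
    using disjoint_support[OF perm] that self unfolding disjoint_def by blast
  have inj: "x = y" if "x \<in> cycle_leaders n \<sigma>" "y \<in> cycle_leaders n \<sigma>"
    "set (support \<sigma> x) \<inter> set (support \<sigma> y) \<noteq> {}" for x y
  proof -
    have "x \<in> set (support \<sigma> y)" using that(3) disjoint_support'[OF perm] by blast
    moreover from this have "y \<in> set (support \<sigma> x)" by (rule sym)
    ultimately obtain k l where "x = (\<sigma> ^^ k) y" "y = (\<sigma> ^^ l) x"
      unfolding support_set[OF perm] by blast
    moreover have "(\<sigma> ^^ k) y \<le> y" "(\<sigma> ^^ l) x \<le> x"
      using that(1,2) by (simp_all add: cycle_leaders_def)
    ultimately show ?thesis by simp
  qed
  have dist: "distinct (concat ?css)"
    unfolding distinct_concat_iff
  proof (intro conjI ballI allI impI)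
    show "distinct (removeAll [] ?css)"
      by (intro distinct_removeAll) (auto simp: distinct_map inj_on_def intro: arg_cong[where f = hd] dest: arg_cong[where f = hd] simp: hd_supp simp del: map_eq_conv)
  next
    fix ys assume "ys \<in> set ?css"
    then show "distinct ys" using cycle_of_permutation[OF perm] by auto
  next
    fix ys zs assume A: "ys \<in> set ?css \<and> zs \<in> set ?css \<and> ys \<noteq> zs"
    then obtain x y where "ys = support \<sigma> x" "zs = support \<sigma> y"
      "x \<in> cycle_leaders n \<sigma>" "y \<in> cycle_leaders n \<sigma>" by auto
    then show "set ys \<inter> set zs = {}" using inj[of x y] A by blast
  qed
  have in_n: "(\<sigma> ^^ k) m < n \<longleftrightarrow> m < n" for k m
    using permutes_in_image[OF permutes_funpow[OF \<sigma>], of k m] by simp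
  have set: "set (concat ?css) = {0..<n}"
  proof (intro equalityI subsetI)
    fix x assume "x \<in> set (concat ?css)"
    then show "x \<in> {0..<n}" using in_n by (auto simp: cycle_leaders_def)
  next
    fix x assume x: "x \<in> {0..<n}"
    define m where "m = Max (set (support \<sigma> x))"
    have m: "m \<in> set (support \<sigma> x)" unfolding m_def using self[of x] by (intro Max_in) auto
    have "(\<sigma> ^^ k) m \<le> m" for k
    proof -
      have "(\<sigma> ^^ k) m \<in> set (support \<sigma> m)" unfolding support_set[OF perm] by blast
      then have "(\<sigma> ^^ k) m \<in> set (support \<sigma> x)" using eq[OF m] by simp
      then show ?thesis unfolding m_def by (intro Max_ge) auto
    qed
    moreover have "m < n" using m x in_n by auto
    ultimately have "m \<in> cycle_leaders n \<sigma>" by (simp add: cycle_leaders_def)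
    then show "x \<in> set (concat ?css)" using sym[OF m] by auto
  qed
  have "\<sigma> = foldr (\<circ>) (map cycle_of_list ?css) id" (is "_ = ?f")
  proof
    fix x
    show "\<sigma> x = ?f x"
    proof (cases "x < n")
      case True
      then have "x \<in> set (concat ?css)" unfolding set by simp
      then obtain c where c: "c \<in> set ?css" "x \<in> set c" unfolding set_concat by blast
      then obtain m where "c = support \<sigma> m" by auto
      then have "\<sigma> x = cycle_of_list c x" using cycle_restrict[OF perm] c by blast
      then show ?thesis using foldr_cycles_inside[OF dist c] by metis
    next
      case False
      then have "x \<notin> set (concat ?css)" unfolding set by simp
      then have "?f x = x" by (rule foldr_cycles_outside)
      moreover have "\<sigma> x = x" using False \<sigma> by (simp add: permutes_not_in)
      ultimately show ?thesis by metis
    qed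
  qed
  moreover have "c \<noteq> [] \<and> (\<forall>x\<in>set (tl c). x < hd c)" if c: "c \<in> set ?css" for c
  proof -
    obtain m where m: "c = support \<sigma> m" "m \<in> cycle_leaders n \<sigma>" using c by auto
    have "c = m # tl c" using hd_supp[of m] ne[of m] m by (metis list.collapse)
    moreover have "distinct c" using cycle_of_permutation[OF perm] m by simp
    ultimately have "m \<notin> set (tl c)" by (metis distinct.simps(2))
    moreover have "x \<le> m" if "x \<in> set (tl c)" for x
      using list.set_sel(2)[OF _ that] m ne[of m] by (auto simp: cycle_leaders_def)
    moreover have "hd c = m" using m hd_supp by simp
    ultimately show ?thesis using m ne[of m] by (metis le_neq_implies_less)
  qed
  moreover have "map hd ?css = rev (sorted_list_of_set (cycle_leaders n \<sigma>))"
    using hd_supp by (simp add: comp_def)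
  then have "sorted_wrt (>) (map hd ?css)"
    by (simp add: sorted_wrt_rev)
  ultimately show ?thesis using dist set unfolding chen_form_def by blast
qed

theorem chen_form_ex1:
  assumes "\<sigma> permutes {0..<n}"
  shows "\<exists>!css. chen_form n \<sigma> css"
  using chen_form_exists[OF assms] chen_form_unique[OF assms] by blast

corollary chen_form_iff:
  assumes "\<sigma> permutes {0..<n}"
  shows "chen_form n \<sigma> css \<longleftrightarrow> css = chen_cycles n \<sigma>"
  using chen_form_ex1[OF assms] unfolding chen_cycles_def by (metis the_equality)

end

theory Submission
  imports Defs
begin

text \<open>
  Call \<open>(x + x\<^sup>*) / 2\<close> the scalar part of a dual quaternion \<open>x\<close>. It is a dual number, hence
  central, and it is cyclic in the way a trace is: \<open>x y\<close> and \<open>y x\<close> have the same scalar part.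

  The normalization in the Chen determinant prescribes at which index the product along each
  cycle starts and in which order the cycles are multiplied, and both choices depend on the
  order of the indices. For a Hermitian matrix they turn out to be irrelevant. Reversing the
  direction of a cycle while keeping its leading entry gives a permutation with the same
  number of cycles, and the product along the reversed cycle is the conjugate of the original
  one. Averaging the sum over the two directions of each cycle therefore replaces every cycle
  product by its scalar part (\<open>Cdet_eq_sum_scalar_parts\<close>). Since scalar parts are central, the
  order of the cycles no longer matters, and since they are cyclic, neither does the starting
  index. Each summand now depends only on the number of orbits and on the cyclic order within
  each orbit.

  Conjugating by \<open>P\<^sub>i\<^sub>j\<close> amounts to relabelling the indices by the transposition of \<open>i\<close> and
  \<open>j\<close>. A relabelling by any permutation \<open>\<tau>\<close> carries the orbits of \<open>\<sigma>\<close> to those of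
  \<open>\<tau> \<sigma> \<tau>\<inverse>\<close>, with their cyclic orders, so it merely permutes the summands
  (\<open>Cdet_relabel\<close>).
\<close>

section \<open>Scalar parts of dual quaternions\<close>

lemma qconj_add: "qconj (x + y) = qconj x + qconj y"
  by (rule quat_eqI) simp_all

lemma dqconj_mult: "dqconj (x * y) = dqconj y * dqconj x"
  by (rule dquat_eqI) (simp_all add: qconj_mult qconj_add add.commute)

lemma dqconj_one: "dqconj 1 = 1"
  by (intro dquat_eqI quat_eqI) simp_all

lemma dqconj_prod_list: "dqconj (prod_list xs) = prod_list (map dqconj (rev xs))"
  by (induction xs) (simp_all add: dqconj_one dqconj_mult)

definition scalar_part :: "dquat \<Rightarrow> dquat" where
  "scalar_part x = (1 / 2) *\<^sub>R (x + dqconj x)"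

lemma add_dqconj: "x + dqconj x = 2 *\<^sub>R scalar_part x"
  by (simp add: scalar_part_def)

lemma scalar_part_central: "scalar_part x * y = y * scalar_part x"
  unfolding scalar_part_def
  by (intro dquat_eqI quat_eqI) (simp_all add: algebra_simps)

lemma scalar_part_mult_commute: "scalar_part (x * y) = scalar_part (y * x)"
  unfolding scalar_part_def
  by (intro dquat_eqI quat_eqI) (simp_all add: algebra_simps)

text \<open>The multiplication on \<open>dquat\<close> is not commutative, so products over multisets are
  not at hand; this takes their place when all factors are central.\<close>

lemma prod_list_mset_eq_of_central:
  fixes xs ys :: "'a::monoid_mult list"
  assumes "mset xs = mset ys" and "\<And>x y. x \<in> set xs \<Longrightarrow> x * y = y * x"
  shows "prod_list xs = prod_list ys"
  using assms
proof (induction xs arbitrary: ys)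
  case (Cons x xs)
  from Cons.prems(1) have "x \<in> set ys" by (metis list.set_intros(1) set_mset_mset)
  then obtain us vs where ys: "ys = us @ x # vs" by (meson split_list)
  have "prod_list xs = prod_list us * prod_list vs"
  proof (rule trans[OF Cons.IH[of "us @ vs"]])
    show "mset xs = mset (us @ vs)" using Cons.prems(1) by (simp add: ys)
    show "z * y = y * z" if "z \<in> set xs" for z y using Cons.prems(2) that by simp
  qed simp
  moreover have "x * prod_list us = prod_list us * x" by (rule Cons.prems(2)) simp
  ultimately show ?case by (simp add: ys mult.assoc[symmetric])
qed simp

section \<open>Products along cycles of indices\<close>

lemma cycle_prod_map:
  assumes "\<And>k l. k \<in> set c \<Longrightarrow> l \<in> set c \<Longrightarrow> B $$ (k, l) = A $$ (\<tau> k, \<tau> l)"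
  shows "cycle_prod A (map \<tau> c) = cycle_prod B c"
proof -
  have "zip (map \<tau> c) (rotate1 (map \<tau> c)) = map (map_prod \<tau> \<tau>) (zip c (rotate1 c))"
    by (simp add: rotate1_map zip_map_map map_prod_def)
  moreover have "map (\<lambda>kl. A $$ map_prod \<tau> \<tau> kl) (zip c (rotate1 c)) = map (\<lambda>kl. B $$ kl) (zip c (rotate1 c))"
  proof (intro map_cong refl)
    fix kl assume kl: "kl \<in> set (zip c (rotate1 c))"
    obtain k l where [simp]: "kl = (k, l)" by (cases kl)
    have "k \<in> set c" "l \<in> set c" using set_zip_leftD set_zip_rightD kl by fastforce+
    then show "A $$ map_prod \<tau> \<tau> kl = B $$ kl" using assms by simp
  qed
  ultimately show ?thesis unfolding cycle_prod_def by (simp only: map_map comp_def)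
qed

text \<open>Starting a cycle at another index rotates its list of factors, which a cyclic function
  such as the scalar part does not notice.\<close>

lemma scalar_part_cycle_prod_rotate:
  "scalar_part (cycle_prod A (rotate k c)) = scalar_part (cycle_prod A c)"
proof (induction k)
  case (Suc k)
  have rot: "scalar_part (prod_list (rotate1 xs)) = scalar_part (prod_list xs)" for xs
    by (cases xs) (simp_all add: scalar_part_mult_commute)
  have zip_rot: "zip (rotate1 c) (rotate1 (rotate1 c)) = rotate1 (zip c (rotate1 c))" for c :: "nat list"
  proof (cases c)
    case (Cons x xs)
    have "zip (ys @ [y]) (zs @ [z]) = zip ys zs @ [(y, z)]" if "length ys = length zs"
      for ys zs :: "nat list" and y z using that by simp
    from this[of "xs" "tl xs @ [x]" x "hd (xs @ [x])"] show ?thesis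
      using Cons by (cases xs) simp_all
  qed simp
  have "scalar_part (cycle_prod A (rotate1 c)) = scalar_part (cycle_prod A c)" for c
    by (simp add: cycle_prod_def zip_rot rotate1_map[symmetric] rot)
  then show ?case using Suc by simp
qed simp

text \<open>The first entry stays in place because in a Chen normal form it has to be the maximum of
  the cycle.\<close>

fun reverse_cycle :: "'a list \<Rightarrow> 'a list" where
  "reverse_cycle [] = []"
| "reverse_cycle (x # xs) = x # rev xs"

lemma reverse_cycle_simps [simp]:
  "reverse_cycle (reverse_cycle c) = c" "set (reverse_cycle c) = set c"
  "distinct (reverse_cycle c) = distinct c" "hd (reverse_cycle c) = hd c"
  "set (tl (reverse_cycle c)) = set (tl c)" "reverse_cycle c = [] \<longleftrightarrow> c = []"
  by (cases c; simp)+

lemma hermitian_entry: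
  assumes "A \<in> carrier_mat n n" "dq_hermitian A" "k < n" "l < n"
  shows "A $$ (l, k) = dqconj (A $$ (k, l))"
proof -
  have "A $$ (l, k) = conj_transpose A $$ (l, k)" using assms(2) by (simp add: dq_hermitian_def)
  also have "\<dots> = dqconj (A $$ (k, l))" using assms by (simp add: conj_transpose_def)
  finally show ?thesis .
qed

text \<open>In a Hermitian matrix, traversing an edge of the cycle backwards conjugates its factor;
  traversing all edges in the opposite order as well conjugates the product.\<close>

lemma cycle_prod_reverse_cycle:
  assumes "A \<in> carrier_mat n n" "dq_hermitian A" "set c \<subseteq> {0..<n}"
  shows "cycle_prod A (reverse_cycle c) = dqconj (cycle_prod A c)"
proof (cases c)
  case Nil
  then show ?thesis by (simp add: cycle_prod_def dqconj_one)
next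
  case (Cons x xs)
  let ?z = "zip (x # xs) (xs @ [x])"
  have "rev ?z = zip (rev xs @ [x]) (x # rev xs)"
    using zip_rev[of "x # xs" "xs @ [x]"] by simp
  then have z: "zip (x # rev xs) (rev xs @ [x]) = map (\<lambda>(k, l). (l, k)) (rev ?z)"
    using zip_commute by metis
  have entry: "A $$ (l, k) = dqconj (A $$ (k, l))" if "(k, l) \<in> set ?z" for k l
  proof (rule hermitian_entry[OF assms(1,2)])
    show "k < n" using set_zip_leftD[OF that] assms(3) Cons by auto
    show "l < n" using set_zip_rightD[OF that] assms(3) Cons by auto
  qed
  have "cycle_prod A (reverse_cycle c) = prod_list (map (\<lambda>(k, l). A $$ (l, k)) (rev ?z))"
    by (simp only: Cons cycle_prod_def reverse_cycle.simps rotate1.simps z map_map)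
      (simp add: comp_def case_prod_unfold)
  also have "map (\<lambda>(k, l). A $$ (l, k)) (rev ?z) = map (\<lambda>kl. dqconj (A $$ kl)) (rev ?z)"
    using entry by (intro map_cong refl) (auto simp del: zip_Cons_Cons)
  also have "prod_list \<dots> = dqconj (cycle_prod A c)"
    by (simp add: Cons cycle_prod_def dqconj_prod_list rev_map comp_def)
  finally show ?thesis .
qed

section \<open>Averaging over the orientations of the cycles\<close>

text \<open>These are the normal forms of all permutations. Working with them directly allows a
  single cycle to be reversed without speaking of the underlying permutation.\<close>

definition chen_lists :: "nat \<Rightarrow> nat list list set" where
  "chen_lists n = {css. distinct (concat css) \<and> set (concat css) = {0..<n} \<and>
     (\<forall>c\<in>set css. c \<noteq> [] \<and> (\<forall>x\<in>set (tl c). x < hd c)) \<and> sorted_wrt (>) (map hd css)}"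

lemma foldr_cycles_permutes: "foldr (\<circ>) (map cycle_of_list css) id permutes set (concat css)"
proof (induction css)
  case (Cons c css)
  have "cycle_of_list c permutes set (concat (c # css))"
    by (rule permutes_subset[OF cycle_permutes]) auto
  moreover have "foldr (\<circ>) (map cycle_of_list css) id permutes set (concat (c # css))"
    by (rule permutes_subset[OF Cons]) auto
  ultimately have "cycle_of_list c \<circ> foldr (\<circ>) (map cycle_of_list css) id permutes set (concat (c # css))"
    by (rule permutes_compose[rotated])
  moreover have "foldr (\<circ>) (map cycle_of_list (c # css)) id =
      cycle_of_list c \<circ> foldr (\<circ>) (map cycle_of_list css) id"
    by (rule ext) simp
  ultimately show ?case by argo
qed (simp add: id_def)

lemma bij_betw_chen_cycles: "bij_betw (chen_cycles n) {\<sigma>. \<sigma> permutes {0..<n}} (chen_lists n)"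
proof (rule bij_betw_byWitness)
  let ?f = "\<lambda>css. foldr (\<circ>) (map cycle_of_list css) id"
  have cf: "\<sigma> = ?f (chen_cycles n \<sigma>) \<and> chen_cycles n \<sigma> \<in> chen_lists n" if "\<sigma> permutes {0..<n}" for \<sigma>
    using chen_form_iff[OF that, of "chen_cycles n \<sigma>"] by (simp add: chen_form_def chen_lists_def)
  have perm: "?f css permutes {0..<n}" if "css \<in> chen_lists n" for css
    using foldr_cycles_permutes[of css] that by (simp add: chen_lists_def)
  show "\<forall>\<sigma>\<in>{\<sigma>. \<sigma> permutes {0..<n}}. ?f (chen_cycles n \<sigma>) = \<sigma>" using cf by (metis mem_Collect_eq)
  show "chen_cycles n ` {\<sigma>. \<sigma> permutes {0..<n}} \<subseteq> chen_lists n" using cf by blast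
  show "?f ` chen_lists n \<subseteq> {\<sigma>. \<sigma> permutes {0..<n}}" using perm by blast
  show "\<forall>css\<in>chen_lists n. chen_cycles n (?f css) = css"
  proof
    fix css assume css: "css \<in> chen_lists n"
    then have "chen_form n (?f css) css" by (simp add: chen_form_def chen_lists_def)
    then show "chen_cycles n (?f css) = css" using chen_form_iff[OF perm[OF css]] by metis
  qed
qed

lemma chen_cycles_in_chen_lists: "\<sigma> permutes {0..<n} \<Longrightarrow> chen_cycles n \<sigma> \<in> chen_lists n"
  using bij_betwE[OF bij_betw_chen_cycles] by blast

lemma length_chen_list_le:
  assumes "css \<in> chen_lists n" shows "length css \<le> n"
proof -
  have "length css \<le> length (concat css)" if "\<forall>c\<in>set css. c \<noteq> []" for css :: "nat list list"
    using that
  proof (induction css)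
    case (Cons c css)
    then have "length c > 0" "length css \<le> length (concat css)" by simp_all
    then show ?case unfolding concat.simps length_append list.size by linarith
  qed simp
  then have "length css \<le> length (concat css)" using assms by (simp add: chen_lists_def)
  also have "\<dots> = n"
    using assms distinct_card[of "concat css"] by (simp add: chen_lists_def)
  finally show ?thesis .
qed

text \<open>For \<open>k\<close> beyond the number of cycles this is the identity, so one involution acts on all
  normal forms at once, however many cycles they have.\<close>

definition reverse_nth_cycle :: "nat \<Rightarrow> nat list list \<Rightarrow> nat list list" where
  "reverse_nth_cycle k css = css[k := reverse_cycle (css ! k)]"

lemma reverse_nth_cycle_append:
  "reverse_nth_cycle (length us) (us @ c # vs) = us @ reverse_cycle c # vs"
  by (simp add: reverse_nth_cycle_def)

lemma reverse_nth_cycle_beyond: "length css \<le> k \<Longrightarrow> reverse_nth_cycle k css = css"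
  by (simp add: reverse_nth_cycle_def list_update_beyond)

lemma reverse_nth_cycle_involutive: "reverse_nth_cycle k (reverse_nth_cycle k css) = css"
proof (cases "k < length css")
  case True
  then show ?thesis by (simp add: reverse_nth_cycle_def)
qed (simp add: reverse_nth_cycle_beyond)

lemma reverse_nth_cycle_in_chen_lists:
  assumes "css \<in> chen_lists n" shows "reverse_nth_cycle k css \<in> chen_lists n"
proof (cases "k < length css")
  case True
  then obtain us c vs where *: "css = us @ c # vs" "length us = k"
    using id_take_nth_drop length_take min.absorb4 by metis
  have "reverse_nth_cycle k css = us @ reverse_cycle c # vs"
    using reverse_nth_cycle_append[of us c vs] * by simp
  then show ?thesis using assms unfolding * chen_lists_def by simp
next
  case False
  then show ?thesis using assms by (simp add: reverse_nth_cycle_beyond)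
qed

text \<open>The cycle products are replaced by their scalar parts one position at a time. The
  involution \<open>reverse_nth_cycle k\<close> preserves the sum over all normal forms, and the two
  summands it pairs differ only by conjugation of the factor at position \<open>k\<close>. A cycle of length one or
  two is its own reversal; its product is then self-conjugate and equal to its scalar part, so
  these fixed points of the involution fit the same computation.\<close>

lemma Cdet_eq_sum_scalar_parts:
  assumes A: "A \<in> carrier_mat n n" "dq_hermitian A"
  shows "Cdet A = (\<Sum>\<sigma> | \<sigma> permutes {0..<n}. (- 1) ^ (n - length (chen_cycles n \<sigma>)) *
    prod_list (map (\<lambda>c. scalar_part (cycle_prod A c)) (chen_cycles n \<sigma>)))"
proof -
  \<comment> \<open>Scalar parts in the first \<open>k\<close> positions: \<open>F 0\<close> gives the Chen determinant, and \<open>F n\<close>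
      has no unreplaced factor left because there are at most \<open>n\<close> cycles.\<close>
  define F where "F k css = (- 1) ^ (n - length css) *
    (prod_list (map (\<lambda>c. scalar_part (cycle_prod A c)) (take k css)) *
     prod_list (map (cycle_prod A) (drop k css)))" for k css
  have pair: "F k css + F k (reverse_nth_cycle k css) = 2 *\<^sub>R F (Suc k) css"
    if css: "css \<in> chen_lists n" for k css
  proof (cases "k < length css")
    case True
    then obtain us c vs where *: "css = us @ c # vs" "k = length us"
      using id_take_nth_drop length_take min.absorb4 by metis
    have "set c \<subseteq> {0..<n}" using css unfolding * chen_lists_def by auto
    then have rev: "cycle_prod A (reverse_cycle c) = dqconj (cycle_prod A c)"
      using cycle_prod_reverse_cycle A by blast
    show ?thesis
      by (simp add: * F_def reverse_nth_cycle_append rev distrib_left[symmetric]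
          distrib_right[symmetric] add_dqconj mult.assoc)
  next
    case False
    then show ?thesis by (simp add: F_def reverse_nth_cycle_beyond scaleR_2)
  qed
  have step: "(\<Sum>css\<in>chen_lists n. F k css) = (\<Sum>css\<in>chen_lists n. F (Suc k) css)" for k
  proof -
    have "(\<Sum>css\<in>chen_lists n. F k css) = (\<Sum>css\<in>chen_lists n. F k (reverse_nth_cycle k css))"
      by (rule sum.reindex_bij_witness[of _ "reverse_nth_cycle k" "reverse_nth_cycle k"])
        (simp_all add: reverse_nth_cycle_involutive reverse_nth_cycle_in_chen_lists)
    then have "2 *\<^sub>R (\<Sum>css\<in>chen_lists n. F k css) =
        (\<Sum>css\<in>chen_lists n. F k css + F k (reverse_nth_cycle k css))"
      by (simp add: scaleR_2 sum.distrib)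
    also have "\<dots> = 2 *\<^sub>R (\<Sum>css\<in>chen_lists n. F (Suc k) css)"
      by (simp add: pair scaleR_sum_right)
    finally show ?thesis by simp
  qed
  have all: "(\<Sum>css\<in>chen_lists n. F 0 css) = (\<Sum>css\<in>chen_lists n. F k css)" for k
  proof (induction k)
    case (Suc k)
    then show ?case using step by (rule trans)
  qed simp
  have reindex: "(\<Sum>css\<in>chen_lists n. F k css) = (\<Sum>\<sigma> | \<sigma> permutes {0..<n}. F k (chen_cycles n \<sigma>))" for k
    by (rule sum.reindex_bij_betw[OF bij_betw_chen_cycles, symmetric])
  have "Cdet A = (\<Sum>\<sigma> | \<sigma> permutes {0..<n}. F 0 (chen_cycles n \<sigma>))"
    using A by (simp add: Cdet_def chen_term_def F_def)
  also have "\<dots> = (\<Sum>\<sigma> | \<sigma> permutes {0..<n}. F n (chen_cycles n \<sigma>))"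
    using all[of n] by (simp add: reindex)
  also have "\<dots> = (\<Sum>\<sigma> | \<sigma> permutes {0..<n}. (- 1) ^ (n - length (chen_cycles n \<sigma>)) *
    prod_list (map (\<lambda>c. scalar_part (cycle_prod A c)) (chen_cycles n \<sigma>)))"
    using length_chen_list_le[OF chen_cycles_in_chen_lists] by (intro sum.cong refl) (simp add: F_def)
  finally show ?thesis .
qed

section \<open>Relabelling the indices\<close>

lemma map_support:
  assumes "permutation \<sigma>"
  shows "map \<sigma> (support \<sigma> x) = rotate1 (support \<sigma> x)"
proof -
  have "map \<sigma> (support \<sigma> x) = map (cycle_of_list (support \<sigma> x)) (support \<sigma> x)"
    using cycle_restrict[OF assms] by (intro map_cong refl) blast
  also have "\<dots> = rotate1 (support \<sigma> x)"
    using cyclic_rotation[OF cycle_of_permutation[OF assms], of 1] by simp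
  finally show ?thesis .
qed

lemma support_nonempty: "permutation \<sigma> \<Longrightarrow> support \<sigma> x \<noteq> []"
  using least_power_of_permutation(2)[of \<sigma> x] by simp

lemma hd_support: "permutation \<sigma> \<Longrightarrow> hd (support \<sigma> x) = x"
  using least_power_of_permutation(2)[of \<sigma> x] by (simp add: hd_map)

text \<open>Lists of the same cycle started at different points are rotations of each other, because
  \<open>cycle_eq_support\<close> characterizes \<open>support\<close> by its first entry and the way \<open>\<sigma>\<close> acts on it.\<close>

lemma support_eq_rotate:
  assumes \<sigma>: "permutation \<sigma>" and y: "y \<in> set (support \<sigma> x)"
  obtains k where "support \<sigma> y = rotate k (support \<sigma> x)"
proof -
  from y obtain k where k: "k < length (support \<sigma> x)" "y = support \<sigma> x ! k"
    by (metis in_set_conv_nth)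
  let ?c = "rotate k (support \<sigma> x)"
  have "?c = support \<sigma> (hd ?c)"
  proof (rule cycle_eq_support)
    show "distinct ?c" using cycle_of_permutation[OF \<sigma>] by simp
    show "?c \<noteq> []" using support_nonempty[OF \<sigma>] by simp
    show "map \<sigma> ?c = rotate1 ?c" 
      by (simp only: rotate_map[symmetric] map_support[OF \<sigma>] rotate1_rotate_swap)
  qed
  moreover have "hd ?c = y"
    using k support_nonempty[OF \<sigma>] hd_rotate_conv_nth[of "support \<sigma> x" k] by simp
  ultimately show ?thesis using that[of k] by simp
qed

lemma support_conjugate:
  assumes \<sigma>: "permutation \<sigma>" and \<tau>: "bij \<tau>"
  shows "support (\<tau> \<circ> \<sigma> \<circ> inv_into UNIV \<tau>) (\<tau> x) = map \<tau> (support \<sigma> x)"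
proof -
  let ?c = "map \<tau> (support \<sigma> x)"
  have inj: "inj \<tau>" using \<tau> by (rule bij_is_inj)
  have "?c = support (\<tau> \<circ> \<sigma> \<circ> inv_into UNIV \<tau>) (hd ?c)"
  proof (rule cycle_eq_support)
    show "distinct ?c" using cycle_of_permutation[OF \<sigma>] inj
      by (simp only: distinct_map) (auto intro: inj_on_subset)
    show "?c \<noteq> []" using support_nonempty[OF \<sigma>] by simp
    have "map (\<tau> \<circ> \<sigma> \<circ> inv_into UNIV \<tau>) ?c = map \<tau> (map \<sigma> (support \<sigma> x))"
      using inj by (simp add: comp_def)
    then show "map (\<tau> \<circ> \<sigma> \<circ> inv_into UNIV \<tau>) ?c = rotate1 ?c"
      by (simp only: map_support[OF \<sigma>] rotate1_map)
  qed
  moreover have "hd ?c = \<tau> x" 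
    using hd_support[OF \<sigma>] support_nonempty[OF \<sigma>] by (metis hd_map)
  ultimately show ?thesis by simp
qed

lemma chen_cycle_eq_support:
  assumes \<sigma>: "\<sigma> permutes {0..<n}" and c: "c \<in> set (chen_cycles n \<sigma>)"
  obtains m where "c = support \<sigma> m"
  using chen_form_unique[OF \<sigma>, of "chen_cycles n \<sigma>"] chen_form_iff[OF \<sigma>] c
  by (metis (no_types, lifting) imageE list.set_map)

text \<open>Forgetting order inside the cycles leaves the set of orbits, which is described without
  reference to the order of the indices; this is what can be transported along a relabelling.\<close>

lemma chen_cycles_orbits:
  assumes \<sigma>: "\<sigma> permutes {0..<n}"
  shows "distinct (map set (chen_cycles n \<sigma>))"
    and "set (map set (chen_cycles n \<sigma>)) = (\<lambda>x. set (support \<sigma> x)) ` {0..<n}"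
proof -
  let ?css = "chen_cycles n \<sigma>"
  have perm: "permutation \<sigma>" using \<sigma> permutation_permutes by blast
  have L: "distinct (concat ?css)" "set (concat ?css) = {0..<n}" "\<And>c. c \<in> set ?css \<Longrightarrow> c \<noteq> []"
    using chen_cycles_in_chen_lists[OF \<sigma>] by (auto simp: chen_lists_def)
  have orbit: "set (support \<sigma> x) = set c" if c: "c \<in> set ?css" and x: "x \<in> set c" for c x
  proof -
    obtain m where m: "c = support \<sigma> m" using chen_cycle_eq_support[OF \<sigma> c] .
    obtain k where "support \<sigma> x = rotate k (support \<sigma> m)"
      using support_eq_rotate[OF perm x[unfolded m]] .
    then show ?thesis unfolding m by (simp only: set_rotate)
  qed
  have "[] \<notin> set ?css" using L(3) by blast
  then have "distinct ?css" and disj: "\<And>c d. c \<in> set ?css \<Longrightarrow> d \<in> set ?css \<Longrightarrow> c \<noteq> d \<Longrightarrow> set c \<inter> set d = {}"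
    using L(1) unfolding distinct_concat_iff by auto
  then show "distinct (map set ?css)"
    using L(3) unfolding distinct_map inj_on_def by (metis inf.idem set_empty)
  show "set (map set ?css) = (\<lambda>x. set (support \<sigma> x)) ` {0..<n}"
  proof (intro equalityI subsetI)
    fix S assume "S \<in> set (map set ?css)"
    then obtain c where c: "c \<in> set ?css" "S = set c" by auto
    then have x: "hd c \<in> set c" using L(3) by simp
    then have "hd c \<in> {0..<n}" using c L(2) by auto
    then show "S \<in> (\<lambda>x. set (support \<sigma> x)) ` {0..<n}" using orbit[OF c(1) x] c(2) by blast
  next
    fix S assume "S \<in> (\<lambda>x. set (support \<sigma> x)) ` {0..<n}"
    then obtain x where x: "x \<in> set (concat ?css)" "S = set (support \<sigma> x)" using L(2) by blast
    then obtain c where "c \<in> set ?css" "x \<in> set c" by auto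
    then show "S \<in> set (map set ?css)" using orbit x(2) by auto
  qed
qed

lemma mset_orbits_conjugate:
  assumes \<sigma>: "\<sigma> permutes {0..<n}" and \<tau>: "\<tau> permutes {0..<n}"
  shows "mset (map set (chen_cycles n (\<tau> \<circ> \<sigma> \<circ> inv_into UNIV \<tau>))) =
    mset (map ((`) \<tau>) (map set (chen_cycles n \<sigma>)))"
proof -
  let ?\<sigma>' = "\<tau> \<circ> \<sigma> \<circ> inv_into UNIV \<tau>"
  have \<sigma>': "?\<sigma>' permutes {0..<n}" using \<sigma> \<tau> by (intro permutes_compose permutes_inv)
  have perm: "permutation \<sigma>" using \<sigma> permutation_permutes by blast
  have bij: "bij \<tau>" using \<tau> by (rule permutes_bij)
  have image: "set (support ?\<sigma>' (\<tau> x)) = \<tau> ` set (support \<sigma> x)" for x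
    unfolding support_conjugate[OF perm bij] by (rule list.set_map)
  have "set (map set (chen_cycles n ?\<sigma>')) = (\<lambda>y. set (support ?\<sigma>' y)) ` \<tau> ` {0..<n}"
    using chen_cycles_orbits(2)[OF \<sigma>'] permutes_image[OF \<tau>] by simp
  also have "\<dots> = (\<lambda>x. \<tau> ` set (support \<sigma> x)) ` {0..<n}"
    by (simp only: image_image image)
  also have "\<dots> = set (map ((`) \<tau>) (map set (chen_cycles n \<sigma>)))"
    by (simp only: list.set_map(1)[of "(`) \<tau>"] chen_cycles_orbits(2)[OF \<sigma>] image_image)
  finally have "set (map set (chen_cycles n ?\<sigma>')) = set (map ((`) \<tau>) (map set (chen_cycles n \<sigma>)))" .
  moreover have "distinct (map ((`) \<tau>) (map set (chen_cycles n \<sigma>)))"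
    using chen_cycles_orbits(1)[OF \<sigma>] bij_is_inj[OF bij]
    unfolding distinct_map[of "(`) \<tau>"] by (auto simp: inj_on_def inj_image_eq_iff)
  ultimately show ?thesis
    using set_eq_iff_mset_eq_distinct chen_cycles_orbits(1)[OF \<sigma>'] by blast
qed

text \<open>The two normal forms may list corresponding cycles in a different order and start them at
  different indices; centrality and rotation invariance of the scalar parts absorb this.\<close>

lemma scalar_part_prod_conjugate:
  assumes \<sigma>: "\<sigma> permutes {0..<n}" and \<tau>: "\<tau> permutes {0..<n}"
    and B: "\<And>k l. k < n \<Longrightarrow> l < n \<Longrightarrow> B $$ (k, l) = A $$ (\<tau> k, \<tau> l)"
  shows "prod_list (map (\<lambda>c. scalar_part (cycle_prod A c)) (chen_cycles n (\<tau> \<circ> \<sigma> \<circ> inv_into UNIV \<tau>))) =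
    prod_list (map (\<lambda>c. scalar_part (cycle_prod B c)) (chen_cycles n \<sigma>))"
proof -
  let ?\<sigma>' = "\<tau> \<circ> \<sigma> \<circ> inv_into UNIV \<tau>"
  have \<sigma>': "?\<sigma>' permutes {0..<n}" using \<sigma> \<tau> by (intro permutes_compose permutes_inv)
  have perm: "permutation \<sigma>" "permutation ?\<sigma>'" using \<sigma> \<sigma>' permutation_permutes by blast+
  have bij: "bij \<tau>" using \<tau> by (rule permutes_bij)
  \<comment> \<open>The factor of a cycle as a function of its orbit alone: by rotation invariance any
      starting index in the orbit yields the same value.\<close>
  define w where "w S = scalar_part (cycle_prod A (support ?\<sigma>' (SOME y. y \<in> S)))" for S
  have some: "(SOME y. y \<in> S) \<in> S" if "S \<noteq> {}" for S :: "nat set"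
    using that by (simp add: some_in_eq)
  have rot: "scalar_part (cycle_prod A (support p y)) = scalar_part (cycle_prod A (support p x))"
    if "permutation p" "y \<in> set (support p x)" for p x y
    using support_eq_rotate[OF that] scalar_part_cycle_prod_rotate by metis
  have wA: "w (set c) = scalar_part (cycle_prod A c)" if c: "c \<in> set (chen_cycles n ?\<sigma>')" for c
  proof -
    obtain m where m: "c = support ?\<sigma>' m" using chen_cycle_eq_support[OF \<sigma>' c] .
    then have "(SOME y. y \<in> set c) \<in> set (support ?\<sigma>' m)"
      using some[of "set c"] support_nonempty[OF perm(2)] by simp
    then show ?thesis using rot[OF perm(2)] m unfolding w_def by simp
  qed
  have wB: "w (\<tau> ` set c) = scalar_part (cycle_prod B c)" if c: "c \<in> set (chen_cycles n \<sigma>)" for c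
  proof -
    obtain m where m: "c = support \<sigma> m" using chen_cycle_eq_support[OF \<sigma> c] .
    have mc: "map \<tau> c = support ?\<sigma>' (\<tau> m)" using support_conjugate[OF perm(1) bij] m by simp
    have "\<tau> ` set c = set (support ?\<sigma>' (\<tau> m))" by (simp only: mc[symmetric] set_map)
    moreover have "set (support ?\<sigma>' (\<tau> m)) \<noteq> {}" using support_nonempty[OF perm(2)] by simp
    ultimately have "w (\<tau> ` set c) = scalar_part (cycle_prod A (support ?\<sigma>' (\<tau> m)))"
      using rot[OF perm(2)] some unfolding w_def by metis
    also have "\<dots> = scalar_part (cycle_prod A (map \<tau> c))" by (simp only: mc)
    also have "cycle_prod A (map \<tau> c) = cycle_prod B c"
    proof (rule cycle_prod_map)
      fix k l assume "k \<in> set c" "l \<in> set c"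
      moreover have "set c \<subseteq> {0..<n}"
        using chen_cycles_in_chen_lists[OF \<sigma>] c by (auto simp: chen_lists_def)
      ultimately have "k < n" "l < n" by auto
      then show "B $$ (k, l) = A $$ (\<tau> k, \<tau> l)" by (rule B)
    qed
    finally show ?thesis .
  qed
  have eq_A: "map (\<lambda>c. scalar_part (cycle_prod A c)) (chen_cycles n ?\<sigma>') = map w (map set (chen_cycles n ?\<sigma>'))"
    using wA by simp
  have eq_B: "map (\<lambda>c. scalar_part (cycle_prod B c)) (chen_cycles n \<sigma>) =
      map w (map ((`) \<tau>) (map set (chen_cycles n \<sigma>)))"
    using wB by simp
  have "mset (map (\<lambda>c. scalar_part (cycle_prod A c)) (chen_cycles n ?\<sigma>')) =
      mset (map (\<lambda>c. scalar_part (cycle_prod B c)) (chen_cycles n \<sigma>))"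
    unfolding eq_A eq_B by (simp only: mset_map[of w] mset_orbits_conjugate[OF \<sigma> \<tau>])
  then show ?thesis
    by (rule prod_list_mset_eq_of_central) (auto simp: scalar_part_central)
qed

theorem Cdet_relabel:
  assumes A: "A \<in> carrier_mat n n" "dq_hermitian A" and \<tau>: "\<tau> permutes {0..<n}"
  shows "Cdet (mat n n (\<lambda>(k, l). A $$ (\<tau> k, \<tau> l))) = Cdet A"
proof -
  let ?B = "mat n n (\<lambda>(k, l). A $$ (\<tau> k, \<tau> l))"
  let ?g = "\<lambda>\<sigma>. \<tau> \<circ> \<sigma> \<circ> inv_into UNIV \<tau>"
  let ?t = "\<lambda>A \<sigma>. (- 1) ^ (n - length (chen_cycles n \<sigma>)) *
    prod_list (map (\<lambda>c. scalar_part (cycle_prod A c)) (chen_cycles n \<sigma>))"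
  have \<tau>n: "\<tau> k < n" if "k < n" for k using permutes_in_image[OF \<tau>, of k] that by simp
  have B: "?B \<in> carrier_mat n n" by simp
  have "conj_transpose ?B = ?B"
    by (rule eq_matI) (simp_all add: conj_transpose_def \<tau>n hermitian_entry[OF A, symmetric])
  then have herm: "dq_hermitian ?B" by (simp add: dq_hermitian_def)
  have term_eq: "?t A (?g \<sigma>) = ?t ?B \<sigma>" if \<sigma>: "\<sigma> permutes {0..<n}" for \<sigma>
  proof -
    have "length (chen_cycles n (?g \<sigma>)) = length (chen_cycles n \<sigma>)"
      using arg_cong[OF mset_orbits_conjugate[OF \<sigma> \<tau>], of size] by simp
    then show ?thesis using scalar_part_prod_conjugate[OF \<sigma> \<tau>, of ?B A] by simp
  qed
  have "Cdet ?B = (\<Sum>\<sigma> | \<sigma> permutes {0..<n}. ?t ?B \<sigma>)"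
    by (rule Cdet_eq_sum_scalar_parts[OF B herm])
  also have "\<dots> = (\<Sum>\<sigma> | \<sigma> permutes {0..<n}. ?t A \<sigma>)"
  proof (rule sum.reindex_bij_witness[of _ "\<lambda>\<sigma>. inv_into UNIV \<tau> \<circ> \<sigma> \<circ> \<tau>" ?g])
    fix \<sigma> assume "\<sigma> \<in> {\<sigma>. \<sigma> permutes {0..<n}}"
    then have \<sigma>: "\<sigma> permutes {0..<n}" by simp
    show "inv_into UNIV \<tau> \<circ> ?g \<sigma> \<circ> \<tau> = \<sigma>" by (simp add: fun_eq_iff permutes_inverses[OF \<tau>])
    show "?g (inv_into UNIV \<tau> \<circ> \<sigma> \<circ> \<tau>) = \<sigma>" by (simp add: fun_eq_iff permutes_inverses[OF \<tau>])
    show "?g \<sigma> \<in> {\<sigma>. \<sigma> permutes {0..<n}}"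
      "inv_into UNIV \<tau> \<circ> \<sigma> \<circ> \<tau> \<in> {\<sigma>. \<sigma> permutes {0..<n}}"
      using \<sigma> \<tau> by (auto intro!: permutes_compose permutes_inv)
    show "?t A (?g \<sigma>) = ?t ?B \<sigma>" by (rule term_eq[OF \<sigma>])
  qed
  also have "\<dots> = Cdet A" by (rule Cdet_eq_sum_scalar_parts[OF A, symmetric])
  finally show ?thesis .
qed

lemma switching_mat_conj:
  assumes A: "A \<in> carrier_mat n n" and ij: "i < n" "j < n"
  shows "conj_transpose (switching_mat n i j) * A * switching_mat n i j =
    mat n n (\<lambda>(k, l). A $$ (transpose i j k, transpose i j l))"
proof -
  let ?P = "switching_mat n i j"
  have P: "?P \<in> carrier_mat n n" by (simp add: switching_mat_def)
  have entry: "?P $$ (k, l) = (if k = transpose i j l then 1 else 0)" if "k < n" "l < n" for k l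
  proof -
    have "k = l \<and> l \<notin> {i, j} \<or> (k, l) = (i, j) \<or> (k, l) = (j, i) \<longleftrightarrow> k = transpose i j l"
      by (auto simp: Transposition.transpose_def)
    then show ?thesis by (simp only: switching_mat_index[OF that])
  qed
  have P': "conj_transpose ?P \<in> carrier_mat n n" using P by (simp add: conj_transpose_def)
  have zero: "dqconj 0 = 0" by (intro dquat_eqI quat_eqI) simp_all
  have entry': "conj_transpose ?P $$ (l, k) = (if k = transpose i j l then 1 else 0)"
    if "k < n" "l < n" for k l
    using P that entry[OF that] by (simp add: conj_transpose_def dqconj_one zero)
  have tn: "transpose i j l < n" if "l < n" for l using that ij by (simp add: Transposition.transpose_def)
  have mult_entry: "(X * Y) $$ (k, l) = (\<Sum>m = 0..<n. X $$ (k, m) * Y $$ (m, l))"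
    if "X \<in> carrier_mat n n" "Y \<in> carrier_mat n n" "k < n" "l < n" for X Y :: "dquat mat" and k l
    using that by (simp add: scalar_prod_def)
  have PA: "(conj_transpose ?P * A) $$ (k, l) = A $$ (transpose i j k, l)" if "k < n" "l < n" for k l
  proof -
    have "(conj_transpose ?P * A) $$ (k, l) = (\<Sum>m = 0..<n. conj_transpose ?P $$ (k, m) * A $$ (m, l))"
      by (rule mult_entry[OF P' A that])
    also have "\<dots> = (\<Sum>m = 0..<n. if m = transpose i j k then A $$ (m, l) else 0)"
      using that by (intro sum.cong refl) (simp add: entry')
    also have "\<dots> = A $$ (transpose i j k, l)" using tn that by simp
    finally show ?thesis .
  qed
  have Q: "conj_transpose ?P * A \<in> carrier_mat n n" using P' A by simp
  show ?thesis
  proof (rule eq_matI)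
    fix k l assume "k < dim_row (mat n n (\<lambda>(k, l). A $$ (transpose i j k, transpose i j l)))"
      "l < dim_col (mat n n (\<lambda>(k, l). A $$ (transpose i j k, transpose i j l)))"
    then have kl: "k < n" "l < n" by simp_all
    have "(conj_transpose ?P * A * ?P) $$ (k, l) =
        (\<Sum>m = 0..<n. (conj_transpose ?P * A) $$ (k, m) * ?P $$ (m, l))"
      by (rule mult_entry[OF Q P kl])
    also have "\<dots> = (\<Sum>m = 0..<n. if m = transpose i j l then A $$ (transpose i j k, m) else 0)"
      using kl by (intro sum.cong refl) (simp add: entry PA)
    also have "\<dots> = A $$ (transpose i j k, transpose i j l)" using tn kl by simp
    finally show "(conj_transpose ?P * A * ?P) $$ (k, l) =
        mat n n (\<lambda>(k, l). A $$ (transpose i j k, transpose i j l)) $$ (k, l)"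
      using kl by simp
  qed (use P P' in auto)
qed

theorem lemma3p2:
  fixes A :: "dquat mat" and n i j :: nat
  assumes "A \<in> carrier_mat n n" and "dq_hermitian A" and "i < n" and "j < n"
  shows "Cdet (conj_transpose (switching_mat n i j) * A * switching_mat n i j) = Cdet A"
proof -
  have "transpose i j permutes {0..<n}" using assms(3,4) by (intro permutes_swap_id) simp_all
  then show ?thesis using switching_mat_conj Cdet_relabel assms by metis
qed

end
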